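(* For a positive integer $m$, let $\rho_m$ be the smallest positive integer $n$ such that there are no primes in the set of integers in $(n, n+m-1]$. Let $s$ be a positive integer. If there exists a nontrivial tight $2s$-$(v,k,\lambda)$ design, then $v - 2s \geq \rho_{s+1}$.
   Context: A $t$-$(v,k,\lambda)$ design is a $v$-set $V$ with a collection $B$ of $k$-subsets (blocks) such that every $t$-subset of $V$ lies in exactly $\lambda$ blocks; it is nontrivial if $B$ is not the set of all $k$-subsets of $V$; a $2s$-design is tight if $|B| = \binom{v}{s}$.
   Formalization: The usual convention t ≤ k ≤ v is made part of the definition of a t-(v,k,λ) design; without it the claim fails, e.g. s=2, v=6, k=3, λ=0 with any 15 of the 20 3-subsets as blocks. *)

theory Defs
  imports "HOL-Computational_Algebra.Primes"
begin

text \<open>Intended for \<open>m \<ge> 1\<close>; the witness exists because there are arbitrarily long prime gaps.\<close>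
definition rho :: "nat \<Rightarrow> nat" where
  "rho m = (LEAST n. 0 < n \<and> (\<forall>p \<in> {n<..n + m - 1}. \<not> prime p))"

text \<open>
  A collection of blocks is a set, so there are no repeated blocks. The standing convention
  \<open>t \<le> k \<le> v\<close> is made explicit: for \<open>k < t\<close> any family of \<open>k\<close>-subsets would be a design
  with \<open>lam = 0\<close>, and for \<open>v < t\<close> the balance condition would be vacuous.
\<close>
definition t_design :: "nat \<Rightarrow> nat \<Rightarrow> nat \<Rightarrow> nat \<Rightarrow> 'a set \<Rightarrow> 'a set set \<Rightarrow> bool" where
  "t_design t v k lam V B \<longleftrightarrow>
     t \<le> k \<and> k \<le> v \<and>
     finite V \<and> card V = v \<and>
     (\<forall>b\<in>B. b \<subseteq> V \<and> card b = k) \<and>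
     (\<forall>T. T \<subseteq> V \<and> card T = t \<longrightarrow> card {b \<in> B. T \<subseteq> b} = lam)"

definition nontrivial_design :: "nat \<Rightarrow> 'a set \<Rightarrow> 'a set set \<Rightarrow> bool" where
  "nontrivial_design k V B \<longleftrightarrow> B \<noteq> {b. b \<subseteq> V \<and> card b = k}"

definition tight_design :: "nat \<Rightarrow> nat \<Rightarrow> nat \<Rightarrow> nat \<Rightarrow> 'a set \<Rightarrow> 'a set set \<Rightarrow> bool" where
  "tight_design s v k lam V B \<longleftrightarrow> t_design (2 * s) v k lam V B \<and> card B = v choose s"

end

theory Submission
  imports Defs
begin

text \<open>
  Double counting gives \<open>|B| (k choose 2s) = lam (v choose 2s)\<close>, and tightness turns the left side
  into \<open>(v choose s) (k choose 2s)\<close>. In a nontrivial design \<open>k < v - 2s\<close>, because otherwise the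
  number of blocks avoiding a set of \<open>v - k \<le> 2s\<close> points does not depend on that set, so either
  all \<open>k\<close>-subsets are blocks or none is. A prime in \<open>(v - 2s, v - s]\<close> would therefore exceed \<open>k\<close>
  and divide \<open>v choose 2s\<close>, but neither \<open>v choose s\<close> nor \<open>k choose 2s\<close>.
  Hence \<open>n = v - 2s\<close> is among the integers whose minimum defines \<open>rho (s + 1)\<close>.
\<close>

lemma card_subsets_between:
  assumes "finite A" and "I \<subseteq> A" and "card I \<le> t"
  shows "card {T. I \<subseteq> T \<and> T \<subseteq> A \<and> card T = t} = (card A - card I) choose (t - card I)"
proof -
  have fin: "finite I" using assms(2,1) by (rule finite_subset)
  have "bij_betw (\<lambda>T. T \<union> I) {S. S \<subseteq> A - I \<and> card S = t - card I}
          {T. I \<subseteq> T \<and> T \<subseteq> A \<and> card T = t}"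
  proof (rule bij_betw_byWitness[where f' = "\<lambda>T. T - I"])
    show "(\<lambda>T. T \<union> I) ` {S. S \<subseteq> A - I \<and> card S = t - card I} \<subseteq>
            {T. I \<subseteq> T \<and> T \<subseteq> A \<and> card T = t}"
    proof (rule image_subsetI)
      fix S assume "S \<in> {S. S \<subseteq> A - I \<and> card S = t - card I}"
      then have S: "S \<subseteq> A - I" "card S = t - card I" by auto
      have "finite S" using S(1) assms(1) by (meson finite_Diff finite_subset)
      then have "card (S \<union> I) = card S + card I"
        using S(1) fin by (intro card_Un_disjoint) auto
      with S assms show "S \<union> I \<in> {T. I \<subseteq> T \<and> T \<subseteq> A \<and> card T = t}" by auto
    qed
    show "(\<lambda>T. T - I) ` {T. I \<subseteq> T \<and> T \<subseteq> A \<and> card T = t} \<subseteq>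
            {S. S \<subseteq> A - I \<and> card S = t - card I}"
      using fin by (auto simp: card_Diff_subset)
  qed auto
  then have "card {T. I \<subseteq> T \<and> T \<subseteq> A \<and> card T = t} =
      card {S. S \<subseteq> A - I \<and> card S = t - card I}"
    by (simp add: bij_betw_same_card)
  also have "\<dots> = card (A - I) choose (t - card I)"
    using assms(1) by (intro n_subsets) simp
  also have "card (A - I) = card A - card I"
    using fin assms(2) by (rule card_Diff_subset)
  finally show ?thesis .
qed

lemma t_design_finite_blocks:
  assumes "t_design t v k lam V B"
  shows "finite B"
proof (rule finite_subset)
  show "B \<subseteq> Pow V" "finite (Pow V)" using assms by (auto simp: t_design_def)
qed

text \<open>Double counting of the pairs \<open>(b, T)\<close> with
  \<open>I \<subseteq> T \<subseteq> b\<close>, \<open>b\<close> a block and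
  \<open>card T = t\<close>. With \<open>I = {}\<close> this is the identity relating
  \<open>card B\<close> and \<open>lam\<close>; for general \<open>I\<close> it shows that the
  number of blocks through \<open>I\<close> depends only on \<open>card I\<close>.\<close>

lemma t_design_card_containing:
  assumes des: "t_design t v k lam V B" and "I \<subseteq> V" and "card I \<le> t"
  shows "card {b \<in> B. I \<subseteq> b} * ((k - card I) choose (t - card I)) =
    lam * ((v - card I) choose (t - card I))"
proof -
  have fin: "finite V" "card V = v" using des by (auto simp: t_design_def)
  have finB: "finite B" using des by (rule t_design_finite_blocks)
  let ?X = "{b \<in> B. I \<subseteq> b}"
  let ?Y = "{T. I \<subseteq> T \<and> T \<subseteq> V \<and> card T = t}"
  have finY: "finite ?Y" using fin(1) by simp
  have "card ?X * ((k - card I) choose (t - card I)) = (\<Sum>b\<in>?X. card {T \<in> ?Y. T \<subseteq> b})"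
  proof -
    have "card {T \<in> ?Y. T \<subseteq> b} = (k - card I) choose (t - card I)" if "b \<in> ?X" for b
    proof -
      have b: "b \<subseteq> V" "card b = k" "I \<subseteq> b" using that des by (auto simp: t_design_def)
      have "{T \<in> ?Y. T \<subseteq> b} = {T. I \<subseteq> T \<and> T \<subseteq> b \<and> card T = t}" using b by auto
      then show ?thesis
        using card_subsets_between[of b I t] b fin(1) assms(3) finite_subset by metis
    qed
    then show ?thesis by simp
  qed
  also have "\<dots> = (\<Sum>T\<in>?Y. card {b \<in> ?X. T \<subseteq> b})"
    using finB finY by (intro sum_multicount_gen) auto
  also have "\<dots> = (\<Sum>T\<in>?Y. lam)"
  proof (rule sum.cong)
    fix T assume T: "T \<in> ?Y"
    then have "{b \<in> ?X. T \<subseteq> b} = {b \<in> B. T \<subseteq> b}" by auto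
    with T des show "card {b \<in> ?X. T \<subseteq> b} = lam" by (simp add: t_design_def)
  qed simp
  also have "\<dots> = lam * ((v - card I) choose (t - card I))"
    using card_subsets_between[OF fin(1) assms(2,3)] fin(2) by simp
  finally show ?thesis .
qed

text \<open>Induction on the avoided set: blocks avoiding \<open>insert x J\<close> are those
  avoiding \<open>J\<close>, less those that also contain \<open>x\<close>. Since \<open>x\<close>
  then moves into the contained set, \<open>I\<close> has to vary in the induction.\<close>

lemma t_design_card_containing_avoiding:
  assumes des: "t_design t v k lam V B"
    and "finite J" "I \<subseteq> V" "J \<subseteq> V" "I \<inter> J = {}"
    and "I' \<subseteq> V" "J' \<subseteq> V" "I' \<inter> J' = {}"
    and "card I' = card I" "card J' = card J" "card I + card J \<le> t"
  shows "card {b \<in> B. I \<subseteq> b \<and> J \<inter> b = {}} = card {b \<in> B. I' \<subseteq> b \<and> J' \<inter> b = {}}"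
  using assms(2-)
proof (induction J arbitrary: I I' J' rule: finite_induct)
  case empty
  have "finite V" "t \<le> k" using des by (auto simp: t_design_def)
  have "finite J'" using empty.prems(5) \<open>finite V\<close> by (rule finite_subset)
  then have "J' = {}" using empty.prems(8) by simp
  \<comment> \<open>As \<open>t \<le> k\<close>, this factor is positive and cancels from the two
    counts.\<close>
  have "(k - card I) choose (t - card I) > 0" using \<open>t \<le> k\<close> by (simp add: zero_less_binomial)
  moreover have "card {b \<in> B. I \<subseteq> b} * ((k - card I) choose (t - card I)) =
      card {b \<in> B. I' \<subseteq> b} * ((k - card I) choose (t - card I))"
    using t_design_card_containing[OF des, of I] t_design_card_containing[OF des, of I']
      empty.prems by simp
  ultimately have "card {b \<in> B. I \<subseteq> b} = card {b \<in> B. I' \<subseteq> b}" by simp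
  then show ?case using \<open>J' = {}\<close> by simp
next
  case (insert x J)
  have finV: "finite V" using des by (auto simp: t_design_def)
  have finB: "finite B" using des by (rule t_design_finite_blocks)
  have split: "card {b \<in> B. K \<subseteq> b \<and> insert y L \<inter> b = {}} +
      card {b \<in> B. insert y K \<subseteq> b \<and> L \<inter> b = {}} = card {b \<in> B. K \<subseteq> b \<and> L \<inter> b = {}}"
    for K L y
  proof -
    have "{b \<in> B. K \<subseteq> b \<and> L \<inter> b = {}} = {b \<in> B. K \<subseteq> b \<and> insert y L \<inter> b = {}} \<union>
      {b \<in> B. insert y K \<subseteq> b \<and> L \<inter> b = {}}" by auto
    then show ?thesis using finB by (simp add: card_Un_disjoint disjoint_iff)
  qed
  have "card J' = Suc (card J)" using insert by simp
  then obtain x' L where J': "J' = insert x' L" "x' \<notin> L" "card L = card J"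
    by (auto simp: card_Suc_eq)
  have finI: "finite I" "finite I'"
    using insert.prems(1,4) finV by (auto intro: finite_subset)
  have "card {b \<in> B. I \<subseteq> b \<and> J \<inter> b = {}} = card {b \<in> B. I' \<subseteq> b \<and> L \<inter> b = {}}"
    using insert.prems insert.hyps J' by (intro insert.IH) auto
  \<comment> \<open>Disjointness puts \<open>x\<close> outside \<open>I\<close> and
    \<open>x'\<close> outside \<open>I'\<close>, so both contained sets grow by one point; the total
    of the two sizes is unchanged and stays at most \<open>t\<close>.\<close>
  moreover have "card {b \<in> B. insert x I \<subseteq> b \<and> J \<inter> b = {}} =
      card {b \<in> B. insert x' I' \<subseteq> b \<and> L \<inter> b = {}}"
    using insert.prems insert.hyps J' finI by (intro insert.IH) auto
  ultimately show ?case using split[of I x J] split[of I' x' L] J' by simp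
qed

lemma t_design_nontrivial_imp_block_size:
  assumes des: "t_design t v k lam V B" and "B \<noteq> {}" and nontriv: "nontrivial_design k V B"
  shows "k + t < v"
proof (rule ccontr)
  assume "\<not> k + t < v"
  then have small: "v - k \<le> t" by simp
  have V: "finite V" "card V = v" and blocks: "\<And>b. b \<in> B \<Longrightarrow> b \<subseteq> V \<and> card b = k"
    using des by (auto simp: t_design_def)
  \<comment> \<open>A block avoiding \<open>V - c\<close> lies inside \<open>c\<close> and has the
    same size, hence is \<open>c\<close>. So counting these blocks tests whether
    \<open>c \<in> B\<close>.\<close>
  have eq: "{b \<in> B. {} \<subseteq> b \<and> (V - c) \<inter> b = {}} = B \<inter> {c}" if "c \<subseteq> V" "card c = k" for c
  proof -
    have "b = c" if "b \<in> B" "(V - c) \<inter> b = {}" for b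
      using that blocks[of b] \<open>c \<subseteq> V\<close> \<open>card c = k\<close> V
      by (intro card_subset_eq) (auto intro: finite_subset)
    then show ?thesis by auto
  qed
  have compl: "card (V - c) = v - k" if "c \<subseteq> V" "card c = k" for c
    using that V by (metis card_Diff_subset finite_subset)
  obtain b where b: "b \<in> B" using assms(2) by auto
  have "c \<in> B" if c: "c \<subseteq> V" "card c = k" for c
  proof -
    have "card {d \<in> B. {} \<subseteq> d \<and> (V - c) \<inter> d = {}} = card {d \<in> B. {} \<subseteq> d \<and> (V - b) \<inter> d = {}}"
      using c blocks[OF b] V small
      by (intro t_design_card_containing_avoiding[OF des]) (auto simp: compl)
    then have "card (B \<inter> {c}) = card (B \<inter> {b})"
      using eq[OF c] eq[of b] blocks[OF b] by simp
    with b show "c \<in> B" by (cases "c \<in> B") auto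
  qed
  with blocks nontriv show False by (auto simp: nontrivial_design_def)
qed

text \<open>The prime divides \<open>fact n\<close>, but neither \<open>fact k\<close> nor
  \<open>fact (n - k)\<close>, as both \<open>k\<close> and \<open>n - k\<close> are below
  \<open>p\<close>.\<close>

lemma prime_dvd_binomial:
  fixes p n k :: nat
  assumes "prime p" and "k < p" and "p \<le> n" and "n < p + k"
  shows "p dvd (n choose k)"
proof -
  have "p dvd fact n" using assms by (simp add: prime_dvd_fact_iff)
  also have "fact n = fact k * fact (n - k) * (n choose k)"
    using assms by (simp add: binomial_fact_lemma)
  finally have "p dvd fact k \<or> p dvd fact (n - k) \<or> p dvd (n choose k)"
    using assms(1) by (simp add: prime_dvd_mult_iff)
  moreover have "\<not> p \<le> k" "\<not> p \<le> n - k" using assms by auto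
  ultimately show ?thesis using assms(1) by (simp add: prime_dvd_fact_iff)
qed

lemma prime_not_dvd_binomial_small:
  fixes p n k :: nat
  assumes "prime p" and "n < p" and "k \<le> n"
  shows "\<not> p dvd (n choose k)"
proof
  assume "p dvd (n choose k)"
  then have "p dvd fact n" using binomial_fact_lemma[OF assms(3)] by (metis dvd_mult)
  with assms show False by (simp add: prime_dvd_fact_iff)
qed

text \<open>The numerator of \<open>n choose k\<close> is the product of \<open>n - i\<close> over
  \<open>i < k\<close>, and all these factors lie strictly between \<open>p\<close> and
  \<open>2 * p\<close>. The induction on \<open>k\<close> adds one factor at a time.\<close>

lemma prime_not_dvd_binomial_upper:
  fixes p n k :: nat
  assumes p: "prime p" and "p + k \<le> n" and "n < 2 * p"
  shows "\<not> p dvd (n choose k)"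
  using assms(2)
proof (induction k)
  case 0
  show ?case using p by (simp add: prime_nat_iff)
next
  case (Suc k)
  have "\<not> p dvd n - k"
  proof
    assume "p dvd n - k"
    then obtain c where "n - k = p * c" by (rule dvdE)
    with Suc.prems \<open>n < 2 * p\<close> have "p * 1 < p * c" "p * c < p * 2" by linarith+
    then show False by simp
  qed
  with Suc p have "\<not> p dvd (n choose k) * (n - k)" by (simp add: prime_dvd_mult_iff)
  \<comment> \<open>Both sides equal \<open>n * ((n - 1) choose k)\<close>.\<close>
  moreover have "(n choose k) * (n - k) = (n choose Suc k) * Suc k"
    using binomial_absorb_comp[of n k] binomial_absorption[of k n]
    by (simp add: mult.commute)
  ultimately show ?case by (metis dvd_mult2)
qed

theorem theorem5p1:
  fixes s v k lam :: nat
  assumes "0 < s"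
    and "\<exists>(V :: 'a set) B. tight_design s v k lam V B \<and> nontrivial_design k V B"
  shows "int v - 2 * int s \<ge> int (rho (s + 1))"
proof -
  obtain V :: "'a set" and B where des: "t_design (2 * s) v k lam V B"
    and tight: "card B = v choose s" and nontriv: "nontrivial_design k V B"
    using assms(2) by (auto simp: tight_design_def)
  have k: "2 * s \<le> k" "k \<le> v" using des by (auto simp: t_design_def)
  \<comment> \<open>Tightness excludes the empty family, which counts as nontrivial for every
    \<open>k \<le> v\<close>.\<close>
  then have "v choose s > 0" by simp
  with tight have "B \<noteq> {}" by auto
  from des this nontriv have kv: "k + 2 * s < v" by (rule t_design_nontrivial_imp_block_size)
  have count: "(v choose s) * (k choose (2 * s)) = lam * (v choose (2 * s))"
    using t_design_card_containing[OF des, of "{}"] tight by simp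
  have "\<not> prime p" if "p \<in> {v - 2 * s<..v - 2 * s + (s + 1) - 1}" for p
  proof
    assume p: "prime p"
    \<comment> \<open>With \<open>kv\<close> this gives
      \<open>2 * s \<le> k < v - 2 * s < p\<close>, and hence \<open>v < p + 2 * s < 2 * p\<close>:
      all the size conditions of the three divisibility lemmas.\<close>
    have range: "v < p + 2 * s" "p + s \<le> v" using that kv by auto
    have "p dvd (v choose (2 * s))"
      using p range kv k by (intro prime_dvd_binomial) auto
    then have "p dvd (v choose s) * (k choose (2 * s))" unfolding count by simp
    moreover have "\<not> p dvd (v choose s)"
      using p range kv k by (intro prime_not_dvd_binomial_upper) auto
    moreover have "\<not> p dvd (k choose (2 * s))"
      using p range kv k by (intro prime_not_dvd_binomial_small) auto
    ultimately show False using p by (simp add: prime_dvd_mult_iff)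
  qed
  \<comment> \<open>The strict bound \<open>kv\<close> makes the candidate \<open>v - 2 * s\<close>
    positive; it also makes the truncated subtraction agree with the integer one.\<close>
  then have "rho (s + 1) \<le> v - 2 * s"
    unfolding rho_def using kv by (intro Least_le) auto
  then show ?thesis using kv by linarith
qed

end
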